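(* Let $p_1,p_2>1$ be constants with $p_1\le p_2$. Given an input array of size $n$, the optimized Melbourne shuffle $\mathrm{optim\_shuffle}(I,\pi,O)$ (with parameters $p_1,p_2$) executes $O(\sqrt n)$ operations, each exchanging a message of size $O(\sqrt n)$, between a user with private memory of size $O(\sqrt n)$ and a server with storage of size $O(n)$. Also, the user and the server perform $O(n)$ work.
   Context: Conventions. $n$ is a fourth power of an integer; rounding of $p_1\sqrt[4]n$, $p_2\sqrt[4]n$ is ignored. Sizes are measured in number of elements (plus constant space for a key and permutation seeds); work is measured in elementary steps, with one encryption, decryption or evaluation of the permutation on one element counted as one step. Elements are equal-size pairs $(x,v)$ with distinct keys $x\in[1,n]$. Storage model. A client (user) accesses arrays on a server through operations: getRange$(S,\mathrm{loc},\ell)$ returns the $\ell$ elements of array $S$ at positions starting at loc; putRange$(S,\mathrm{loc},a)$ writes the array $a$ into $S$ starting at loc; getRangeDist and putRangeDist do the same for several ranges in one operation. Each call is one operation (one I/O); its message size is the total number of elements transferred; the server's work for it is proportional to that number. All elements on the server are encrypted; each element read is decrypted and re-encrypted before being written back. Single pass $\mathrm{optim\_shuffle\_pass}(I,T_1,T_2,\rho,O)$. $I$ and $O$ have $n$ positions, $T_1$ has $p_1n$ and $T_2$ has $p_2n$ positions. Each array is split into $\sqrt n$ consecutive buckets (of size $\sqrt n$, $\sqrt n$, $p_1\sqrt n$, $p_2\sqrt n$, respectively), and the buckets are grouped into $\sqrt[4]n$ consecutive chunks of $\sqrt[4]n$ buckets each. Distribution phase I: for each bucket $i$ of $I$ in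 order, read and decrypt it; for each chunk index $c$ collect the elements $(x,v)$ whose target position $\rho(x)$ lies in chunk $c$ of $O$. If some collection has more than $p_1\sqrt[4]n$ elements, output fail and stop. Otherwise pad each of the $\sqrt[4]n$ batches with dummies to exactly $p_1\sqrt[4]n$ elements, encrypt, and write batch $c$ into chunk $c$ of $T_1$ at offset $i\cdot p_1\sqrt[4]n$ (all batches in one putRangeDist). Distribution phase II: for each chunk $i$ of $T_1$ and each bucket $j$ in it, in order, read and decrypt the bucket, discard dummies, and for each $b\in\{0,\dots,\sqrt[4]n-1\}$ collect the real elements whose target position $\rho(x)$ lies in the $b$-th bucket of chunk $i$ of $O$. If some collection has more than $p_2\sqrt[4]n$ elements, output fail and stop. Otherwise pad each batch with dummies to exactly $p_2\sqrt[4]n$ elements, encrypt, and write batch $b$ into the $b$-th bucket of chunk $i$ of $T_2$ at offset $j\cdot p_2\sqrt[4]n$ (all batches in one putRangeDist). Clean-up phase: for each bucket $j$ of $T_2$ in order, read and decrypt it, remove dummies, sort the remaining $\sqrt n$ elements by $\rho(x)$, re-encrypt them, and write them as bucket $j$ of $O$. Optimized Melbourne shuffle $\mathrm{optim\_shuffle}(I,\pi,O)$. Pick a random permutation $\pi_1$; run $\mathrm{optim\_shuffle\_pass}(I,T_1,T_2,\pi_1,O)$; set $I\leftarrow O$; run $\mathrm{optim\_shuffle\_pass}(I,T_1,T_2,\pi,O)$. *)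

theory Defs
  imports
    "HOL-Probability.Probability_Mass_Function"
    "HOL-Library.Landau_Symbols"
    "HOL-Combinatorics.Permutations"
    "HOL-Library.Monad_Syntax"
begin

section \<open>Client and server\<close>

datatype 'v cell = Dummy | Elem (cell_key: nat) (cell_val: 'v)

datatype array = Arr_I | Arr_T1 | Arr_T2 | Arr_O

text \<open>
  The server only sees the arrays of ciphertexts in \<open>server\<close>.  The private memory of the user
  consists of \<open>inbuf\<close> (ciphertexts just received), \<open>colls\<close> (plaintext collections) and \<open>outbuf\<close>
  (encrypted batches waiting to be sent).  The remaining fields are instrumentation, except for
  \<open>nonce\<close>, which numbers the encryptions so that each of them uses fresh randomness: the
  encryption function receives the number of the encryption as an argument and may look up its
  random coins there.

  \<open>msgs\<close> lists the message sizes (in elements) of the operations executed so far, in order.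
\<close>

record ('ct, 'v) machine =
  server :: "array \<Rightarrow> 'ct list"
  inbuf :: "'ct list"
  colls :: "'v cell list list"
  outbuf :: "'ct list list"
  nonce :: nat
  msgs :: "nat list"
  private_peak :: nat
  storage_peak :: nat
  user_work :: nat
  server_work :: nat

text \<open>
  The constant 4 stands for the key, the seeds of the two permutations and a register for the
  element that is currently being processed.
\<close>

definition private_size :: "('ct, 'v) machine \<Rightarrow> nat" where
  "private_size s = 4 + length (inbuf s) + sum_list (map length (colls s))
     + sum_list (map length (outbuf s))"

definition storage_size :: "('ct, 'v) machine \<Rightarrow> nat" where
  "storage_size s = (\<Sum>a\<leftarrow>[Arr_I, Arr_T1, Arr_T2, Arr_O]. length (server s a))"

definition update_peaks :: "('ct, 'v) machine \<Rightarrow> ('ct, 'v) machine" where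
  "update_peaks s = s\<lparr>private_peak := max (private_peak s) (private_size s),
     storage_peak := max (storage_peak s) (storage_size s)\<rparr>"


section \<open>Instrumented programs\<close>

text \<open>
  A program transforms the machine state and either returns a value or stops with \<^const>\<open>None\<close>
  (output fail); the costs incurred before a failure are kept.
\<close>

type_synonym ('ct, 'v, 'a) prog = "('ct, 'v) machine \<Rightarrow> 'a option \<times> ('ct, 'v) machine"

definition ret :: "'a \<Rightarrow> ('ct, 'v, 'a) prog" where
  "ret a s = (Some a, s)"

definition bind_prog ::
  "('ct, 'v, 'a) prog \<Rightarrow> ('a \<Rightarrow> ('ct, 'v, 'b) prog) \<Rightarrow> ('ct, 'v, 'b) prog" where
  "bind_prog m f s = (case m s of (None, s') \<Rightarrow> (None, s') | (Some a, s') \<Rightarrow> f a s')"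

adhoc_overloading Monad_Syntax.bind \<rightleftharpoons> bind_prog

definition stop_fail :: "('ct, 'v, 'a) prog" where
  "stop_fail s = (None, s)"

text \<open>\<open>user_step k f\<close> is a local computation of the user that takes \<open>k\<close> elementary steps.\<close>

definition user_step ::
  "nat \<Rightarrow> (('ct, 'v) machine \<Rightarrow> 'a \<times> ('ct, 'v) machine) \<Rightarrow> ('ct, 'v, 'a) prog" where
  "user_step k f s = (let (a, s') = f s in
     (Some a, update_peaks (s'\<lparr>user_work := user_work s' + k\<rparr>)))"

definition tick :: "('ct, 'v, unit) prog" where
  "tick = user_step 1 (\<lambda>s. ((), s))"

text \<open>
  \<open>server_op m u w f\<close> is one operation with a message of \<open>m\<close> elements and server work \<open>w\<close>.
  The user spends \<open>u\<close> steps for issuing it, and one more for each element sent or received.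
\<close>

definition server_op ::
  "nat \<Rightarrow> nat \<Rightarrow> nat \<Rightarrow> (('ct, 'v) machine \<Rightarrow> ('ct, 'v) machine) \<Rightarrow> ('ct, 'v, unit) prog" where
  "server_op m u w f s = (let s' = f s in
     (Some (), update_peaks (s'\<lparr>msgs := msgs s' @ [m], user_work := user_work s' + u + m,
        server_work := server_work s' + w\<rparr>)))"

fun for_each :: "'i list \<Rightarrow> ('i \<Rightarrow> ('ct, 'v, unit) prog) \<Rightarrow> ('ct, 'v, unit) prog" where
  "for_each [] f = ret ()"
| "for_each (i # is) f = do { tick; f i; for_each is f }"


subsection \<open>Server operations\<close>

definition getRange :: "array \<Rightarrow> nat \<Rightarrow> nat \<Rightarrow> ('ct, 'v, unit) prog" where
  "getRange A loc l s =
     (let xs = take l (drop loc (server s A))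
      in server_op (length xs) 1 (length xs) (\<lambda>s. s\<lparr>inbuf := xs\<rparr>) s)"

definition write_range :: "nat \<Rightarrow> 'ct list \<Rightarrow> 'ct list \<Rightarrow> 'ct list" where
  "write_range loc xs A =
     map (\<lambda>k. if loc \<le> k \<and> k < loc + length xs then xs ! (k - loc) else A ! k) [0..<length A]"

text \<open>Writes the batches waiting in \<open>outbuf\<close> at the given locations, in one operation.\<close>

definition putRangeDist :: "array \<Rightarrow> nat list \<Rightarrow> ('ct, 'v, unit) prog" where
  "putRangeDist A locs s =
     (let m = sum_list (map length (outbuf s));
          A' = fold (\<lambda>(loc, xs). write_range loc xs) (zip locs (outbuf s)) (server s A)
      in server_op m (1 + length locs) m
           (\<lambda>s. s\<lparr>server := (server s)(A := A'), outbuf := []\<rparr>) s)"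

definition putRange :: "array \<Rightarrow> nat \<Rightarrow> ('ct, 'v, unit) prog" where
  "putRange A loc = putRangeDist A [loc]"

text \<open>
  Allocating an array (with unspecified contents) and copying an array on the server transfer no
  elements, but each is charged as one operation with server work equal to the length of the array.
\<close>

definition allocate :: "array \<Rightarrow> nat \<Rightarrow> ('ct, 'v, unit) prog" where
  "allocate A l = server_op 0 1 l (\<lambda>s. s\<lparr>server := (server s)(A := replicate l undefined)\<rparr>)"

definition copy_array :: "array \<Rightarrow> array \<Rightarrow> ('ct, 'v, unit) prog" where
  "copy_array A B s =
     server_op 0 1 (length (server s B)) (\<lambda>s. s\<lparr>server := (server s)(A := server s B)\<rparr>) s"


subsection \<open>Elementary steps of the user\<close>

definition decrypt_next :: "('ct \<Rightarrow> 'v cell) \<Rightarrow> ('ct, 'v, 'v cell) prog" where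
  "decrypt_next dec = user_step 1 (\<lambda>s.
     case inbuf s of [] \<Rightarrow> (Dummy, s) | ct # cts \<Rightarrow> (dec ct, s\<lparr>inbuf := cts\<rparr>))"

definition encrypt_next :: "(nat \<Rightarrow> 'v cell \<Rightarrow> 'ct) \<Rightarrow> nat \<Rightarrow> ('ct, 'v, unit) prog" where
  "encrypt_next enc c = user_step 1 (\<lambda>s.
     case colls s ! c of
       [] \<Rightarrow> ((), s)
     | e # es \<Rightarrow> ((), s\<lparr>colls := (colls s)[c := es],
                      outbuf := (outbuf s)[c := outbuf s ! c @ [enc (nonce s) e]],
                      nonce := Suc (nonce s)\<rparr>))"

text \<open>
  Target position of the element with key \<open>x\<close>.  Positions in arrays are counted from 0, whereas
  the permutations act on \<open>{1..n}\<close> like the keys do.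
\<close>

definition eval_perm :: "(nat \<Rightarrow> nat) \<Rightarrow> nat \<Rightarrow> ('ct, 'v, nat) prog" where
  "eval_perm \<rho> x = user_step 1 (\<lambda>s. (\<rho> x - 1, s))"

definition new_colls :: "nat \<Rightarrow> ('ct, 'v, unit) prog" where
  "new_colls k = user_step k (\<lambda>s. ((), s\<lparr>colls := replicate k []\<rparr>))"

definition new_outbuf :: "nat \<Rightarrow> ('ct, 'v, unit) prog" where
  "new_outbuf k = user_step k (\<lambda>s. ((), s\<lparr>outbuf := replicate k []\<rparr>))"

definition coll_length :: "nat \<Rightarrow> ('ct, 'v, nat) prog" where
  "coll_length c = user_step 1 (\<lambda>s. (length (colls s ! c), s))"

definition push :: "nat \<Rightarrow> 'v cell \<Rightarrow> ('ct, 'v, unit) prog" where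
  "push c e = user_step 1 (\<lambda>s. ((), s\<lparr>colls := (colls s)[c := colls s ! c @ [e]]\<rparr>))"

text \<open>For sorting, collection 0 serves as a table of \<open>k\<close> slots.\<close>

definition new_slots :: "nat \<Rightarrow> ('ct, 'v, unit) prog" where
  "new_slots k = user_step k (\<lambda>s. ((), s\<lparr>colls := [replicate k Dummy]\<rparr>))"

definition place :: "nat \<Rightarrow> 'v cell \<Rightarrow> ('ct, 'v, unit) prog" where
  "place t e = user_step 1 (\<lambda>s. ((), s\<lparr>colls := (colls s)[0 := (colls s ! 0)[t := e]]\<rparr>))"

text \<open>
  The clean-up phase sorts the elements of a bucket by their target positions.  Since these fill
  exactly one bucket of the output array, it is enough to place each element into its slot, which
  takes linear time; the following fact says that the result is the sorted sequence.
\<close>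

lemma length_fold_place [simp]:
  "length (fold (\<lambda>e slots. slots[f e := e]) xs ys) = length ys"
  by (induction xs arbitrary: ys) auto

lemma nth_fold_place:
  assumes "distinct (map f xs)" and "e \<in> set xs" and "f e < length ys"
  shows "fold (\<lambda>e slots. slots[f e := e]) xs ys ! f e = e"
  using assms
proof (induction xs rule: rev_induct)
  case Nil
  then show ?case by simp
next
  case (snoc x xs)
  show ?case
  proof (cases "e = x")
    case True
    then show ?thesis using snoc.prems by simp
  next
    case False
    then have e: "e \<in> set xs" using snoc.prems by simp
    with snoc.prems have "f x \<noteq> f e" by auto
    with snoc e show ?thesis by simp
  qed
qed

lemma place_eq_sort:
  fixes pos :: "'a \<Rightarrow> nat"
  assumes dist: "distinct (map pos xs)" and img: "pos ` set xs = {a..<a + m}"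
  shows "fold (\<lambda>e slots. slots[pos e - a := e]) xs (replicate m d) = sort_key pos xs"
    (is "?L = _")
proof -
  have inj: "inj_on pos (set xs)" using dist by (simp add: distinct_map)
  have dist': "distinct (map (\<lambda>e. pos e - a) xs)"
    using dist img unfolding distinct_map inj_on_def
    by (metis atLeastLessThan_iff eq_diff_iff imageI)
  have slot: "\<exists>e \<in> set xs. pos e = a + k \<and> ?L ! k = e" if "k < m" for k
  proof -
    have "a + k \<in> pos ` set xs" using that img by simp
    then obtain e where e: "e \<in> set xs" "pos e = a + k" by force
    then have "?L ! (pos e - a) = e"
      using nth_fold_place[OF dist' e(1)] that by simp
    with e show ?thesis by auto
  qed
  have L: "map pos ?L = [a..<a + m]"
  proof (rule nth_equalityI)
    fix i assume "i < length (map pos ?L)"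
    then show "map pos ?L ! i = [a..<a + m] ! i"
      using slot[of i] by auto
  qed simp
  have setL: "set ?L \<subseteq> set xs"
    using slot by (auto simp: set_conv_nth[of ?L])
  have "map pos (sort_key pos xs) = [a..<a + m]"
    by (rule sorted_distinct_set_unique) (use dist img in \<open>auto simp: distinct_map\<close>)
  with L have "map pos ?L = map pos (sort_key pos xs)" by simp
  moreover have "inj_on pos (set ?L \<union> set (sort_key pos xs))"
    using inj setL by (auto intro: inj_on_subset)
  ultimately show ?thesis by (rule map_inj_on)
qed


section \<open>The shuffle\<close>

text \<open>
  \<open>q\<close> is the fourth root of the array size \<open>n = q ^ 4\<close>; hence buckets of the input and output arrays
  have size \<open>q ^ 2\<close>, and chunks have size \<open>q ^ 3\<close>.  \<open>b1\<close> and \<open>b2\<close> are the sizes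
  of the padded batches in the two distribution phases.
\<close>

context
  fixes enc :: "nat \<Rightarrow> 'v cell \<Rightarrow> 'ct"
    and dec :: "'ct \<Rightarrow> 'v cell"
    and q b1 b2 :: nat
begin

definition collect :: "nat \<Rightarrow> (nat \<Rightarrow> nat) \<Rightarrow> (nat \<Rightarrow> nat) \<Rightarrow> ('ct, 'v, unit) prog" where
  "collect l \<rho> idx = do {
     new_colls q;
     for_each [0..<l] (\<lambda>_. do {
       e \<leftarrow> decrypt_next dec;
       (case e of
          Dummy \<Rightarrow> ret ()
        | Elem x v \<Rightarrow> do { t \<leftarrow> eval_perm \<rho> x; push (idx t) e })
     })
   }"

definition send_batches :: "array \<Rightarrow> nat \<Rightarrow> nat list \<Rightarrow> ('ct, 'v, unit) prog" where
  "send_batches T b locs = do {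
     for_each [0..<q] (\<lambda>c. do {
       l \<leftarrow> coll_length c;
       (if l > b then stop_fail else ret ())
     });
     for_each [0..<q] (\<lambda>c. do {
       l \<leftarrow> coll_length c;
       for_each [0..<b - l] (\<lambda>_. push c Dummy)
     });
     new_outbuf q;
     for_each [0..<q] (\<lambda>c. for_each [0..<b] (\<lambda>_. encrypt_next enc c));
     putRangeDist T locs
   }"

definition distribution1 :: "array \<Rightarrow> array \<Rightarrow> (nat \<Rightarrow> nat) \<Rightarrow> ('ct, 'v, unit) prog" where
  "distribution1 In T1 \<rho> =
     for_each [0..<q ^ 2] (\<lambda>i. do {
       getRange In (i * q ^ 2) (q ^ 2);
       collect (q ^ 2) \<rho> (\<lambda>t. t div q ^ 3);
       send_batches T1 b1 (map (\<lambda>c. c * (q ^ 2 * b1) + i * b1) [0..<q])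
     })"

text \<open>
  \<open>(t div q ^ 2) mod q\<close> is the index, within its chunk, of the output bucket containing position
  \<open>t\<close>; all real elements in chunk \<open>i\<close> of \<open>T1\<close> have their targets in chunk \<open>i\<close> of the output.
\<close>

definition distribution2 :: "array \<Rightarrow> array \<Rightarrow> (nat \<Rightarrow> nat) \<Rightarrow> ('ct, 'v, unit) prog" where
  "distribution2 T1 T2 \<rho> =
     for_each [0..<q] (\<lambda>i. for_each [0..<q] (\<lambda>j. do {
       getRange T1 ((i * q + j) * (q * b1)) (q * b1);
       collect (q * b1) \<rho> (\<lambda>t. (t div q ^ 2) mod q);
       send_batches T2 b2 (map (\<lambda>b. (i * q + b) * (q * b2) + j * b2) [0..<q])
     }))"

definition clean_up :: "array \<Rightarrow> (nat \<Rightarrow> nat) \<Rightarrow> array \<Rightarrow> ('ct, 'v, unit) prog" where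
  "clean_up T2 \<rho> Out =
     for_each [0..<q ^ 2] (\<lambda>j. do {
       getRange T2 (j * (q * b2)) (q * b2);
       new_slots (q ^ 2);
       for_each [0..<q * b2] (\<lambda>_. do {
         e \<leftarrow> decrypt_next dec;
         (case e of
            Dummy \<Rightarrow> ret ()
          | Elem x v \<Rightarrow> do { t \<leftarrow> eval_perm \<rho> x; place (t mod q ^ 2) e })
       });
       new_outbuf 1;
       for_each [0..<q ^ 2] (\<lambda>_. encrypt_next enc 0);
       putRange Out (j * q ^ 2)
     })"

definition optim_shuffle_pass ::
  "array \<Rightarrow> array \<Rightarrow> array \<Rightarrow> (nat \<Rightarrow> nat) \<Rightarrow> array \<Rightarrow> ('ct, 'v, unit) prog" where
  "optim_shuffle_pass In T1 T2 \<rho> Out = do {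
     distribution1 In T1 \<rho>;
     distribution2 T1 T2 \<rho>;
     clean_up T2 \<rho> Out
   }"

text \<open>The shuffle for a given outcome \<open>\<pi>1\<close> of the random choice (charged as one step).\<close>

definition optim_shuffle_with :: "(nat \<Rightarrow> nat) \<Rightarrow> (nat \<Rightarrow> nat) \<Rightarrow> ('ct, 'v, unit) prog" where
  "optim_shuffle_with \<pi>1 \<pi> = do {
     allocate Arr_T1 (q ^ 3 * b1);
     allocate Arr_T2 (q ^ 3 * b2);
     tick;
     optim_shuffle_pass Arr_I Arr_T1 Arr_T2 \<pi>1 Arr_O;
     copy_array Arr_I Arr_O;
     optim_shuffle_pass Arr_I Arr_T1 Arr_T2 \<pi> Arr_O
   }"

text \<open>
  Initially the server stores the encrypted input and an output array with arbitrary contents.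
\<close>

definition init_machine :: "(nat \<times> 'v) list \<Rightarrow> 'ct list \<Rightarrow> ('ct, 'v) machine" where
  "init_machine xs out = update_peaks
     \<lparr>server = (\<lambda>_. [])
        (Arr_I := map (\<lambda>(k, (x, v)). enc k (Elem x v)) (List.enumerate 0 xs), Arr_O := out),
      inbuf = [], colls = [], outbuf = [], nonce = length xs, msgs = [],
      private_peak = 0, storage_peak = 0, user_work = 0, server_work = 0\<rparr>"

end

text \<open>Batch sizes \<open>p * root 4 n\<close>, rounded up when this is not an integer.\<close>

definition batch_size :: "real \<Rightarrow> nat \<Rightarrow> nat" where
  "batch_size p q = nat \<lceil>p * real q\<rceil>"

text \<open>
  The distribution of the result (\<^term>\<open>None\<close> for fail) and the final state, for the input \<open>xs\<close>,
  the initial contents \<open>out\<close> of the output array and the desired permutation \<open>\<pi>\<close>.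
\<close>

definition optim_shuffle ::
  "real \<Rightarrow> real \<Rightarrow> nat \<Rightarrow> (nat \<Rightarrow> 'v cell \<Rightarrow> 'ct) \<Rightarrow> ('ct \<Rightarrow> 'v cell) \<Rightarrow>
   (nat \<times> 'v) list \<Rightarrow> (nat \<Rightarrow> nat) \<Rightarrow> 'ct list \<Rightarrow> (unit option \<times> ('ct, 'v) machine) pmf" where
  "optim_shuffle p1 p2 q enc dec xs \<pi> out =
     map_pmf (\<lambda>\<pi>1. optim_shuffle_with enc dec q (batch_size p1 q) (batch_size p2 q) \<pi>1 \<pi>
                      (init_machine enc xs out))
       (pmf_of_set {\<sigma>. \<sigma> permutes {1..q ^ 4}})"

definition encryption_scheme :: "(nat \<Rightarrow> 'v cell \<Rightarrow> 'ct) \<Rightarrow> ('ct \<Rightarrow> 'v cell) \<Rightarrow> bool" where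
  "encryption_scheme enc dec \<longleftrightarrow> (\<forall>r e. dec (enc r e) = e)"

definition input_array :: "nat \<Rightarrow> (nat \<times> 'v) list \<Rightarrow> bool" where
  "input_array n xs \<longleftrightarrow> length xs = n \<and> distinct (map fst xs) \<and> fst ` set xs \<subseteq> {1..n}"

end

theory Submission
  imports Defs
begin

text \<open>
  Every bucket of every array has at most \<open>M = q\<^sup>2 + q b1 + q b2 = O(\<surd>n)\<close> elements, and processing
  one bucket takes one read, one write and \<open>O(M)\<close> steps.  A pass handles \<open>3 \<surd>n\<close> buckets.  The
  bounds are structural: they do not depend on where the elements go, and stopping with fail
  only truncates the execution.
\<close>

text \<open>The peaks are maxima over all intermediate states, so \<open>bounded_state\<close> has
  to survive every elementary step. It is not inductive by itself: a \<open>push\<close> into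
  collections of total size \<open>2 * M\<close> would break it. Each program therefore gets a cost
  triple that also tracks upper bounds for the collections and the output buffer. They grow by a
  fixed amount per loop iteration and start afresh when these buffers are reset. Between buckets the
  bounds \<open>2 * M\<close> and \<open>M\<close> suffice, because the leftovers of one bucket are
  discarded while the next one is processed. The limit \<open>4 + 4 * M\<close> is the constant
  space plus \<open>M\<close> for received ciphertexts, \<open>2 * M\<close> for the collections and
  \<open>M\<close> for the outgoing batches.\<close>

definition coll_size :: "('ct, 'v) machine \<Rightarrow> nat" where
  "coll_size s = sum_list (map length (colls s))"

definition out_size :: "('ct, 'v) machine \<Rightarrow> nat" where
  "out_size s = sum_list (map length (outbuf s))"

definition total_cap :: "(array \<Rightarrow> nat) \<Rightarrow> nat" where
  "total_cap cap = cap Arr_I + cap Arr_T1 + cap Arr_T2 + cap Arr_O"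

text \<open>
  The collections are allowed twice the size of a bucket, so that a collected bucket plus the
  padding fits regardless of whether the overflow test succeeds.
\<close>

definition bounded_state :: "(array \<Rightarrow> nat) \<Rightarrow> nat \<Rightarrow> ('ct, 'v) machine \<Rightarrow> bool" where
  "bounded_state cap M s \<longleftrightarrow>
     (\<forall>a. length (server s a) \<le> cap a) \<and> length (inbuf s) \<le> M \<and>
     coll_size s \<le> 2 * M \<and> out_size s \<le> M \<and> (\<forall>m \<in> set (msgs s). m \<le> M) \<and>
     private_peak s \<le> 4 + 4 * M \<and> storage_peak s \<le> total_cap cap"

text \<open>
  \<open>c\<close>, \<open>x\<close> and \<open>c'\<close>, \<open>x'\<close> bound the collections and the output buffer before and after the
  execution; \<open>k\<close>, \<open>u\<close>, \<open>w\<close> bound the number of operations and the work of the user and the server.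
  Since a failed program is not continued, nothing but the invariant and the costs matters then.
\<close>

definition bounded_prog ::
  "(array \<Rightarrow> nat) \<Rightarrow> nat \<Rightarrow> nat \<Rightarrow> nat \<Rightarrow> ('ct, 'v, 'a) prog \<Rightarrow> nat \<Rightarrow> nat \<Rightarrow>
   nat \<Rightarrow> nat \<Rightarrow> nat \<Rightarrow> bool" where
  "bounded_prog cap M c x f c' x' k u w \<longleftrightarrow>
     (\<forall>s. bounded_state cap M s \<and> coll_size s \<le> c \<and> out_size s \<le> x \<longrightarrow>
        bounded_state cap M (snd (f s)) \<and>
        (fst (f s) \<noteq> None \<longrightarrow> coll_size (snd (f s)) \<le> c' \<and> out_size (snd (f s)) \<le> x') \<and>
        length (msgs (snd (f s))) \<le> length (msgs s) + k \<and>
        user_work (snd (f s)) \<le> user_work s + u \<and>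
        server_work (snd (f s)) \<le> server_work s + w)"

section \<open>Rules for combining cost triples\<close>

lemma bounded_prog_weaken:
  assumes "bounded_prog cap M c x f c' x' k u w"
    and "d \<le> c" "y \<le> x" "c' \<le> d'" "x' \<le> y'" "k \<le> k'" "u \<le> u'" "w \<le> w'"
  shows "bounded_prog cap M d y f d' y' k' u' w'"
  using assms unfolding bounded_prog_def by (meson add_left_mono order_trans)

text \<open>The continuation must satisfy one and the same triple for every value that
  \<open>f\<close> may return; this is what makes the bounds independent of the data. If
  \<open>f\<close> fails, its own costs are the whole costs and lie below the sums.\<close>

lemma bounded_prog_bind:
  assumes "bounded_prog cap M c x f c' x' k u w"
    and "\<And>a. bounded_prog cap M c' x' (g a) c'' x'' k' u' w'"
  shows "bounded_prog cap M c x (bind_prog f g) c'' x'' (k + k') (u + u') (w + w')"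
  unfolding bounded_prog_def
proof (intro allI impI)
  fix s :: "('a, 'b) machine"
  assume pre: "bounded_state cap M s \<and> coll_size s \<le> c \<and> out_size s \<le> x"
  obtain r s' where fs: "f s = (r, s')" by (cases "f s")
  note f = assms(1)[unfolded bounded_prog_def, rule_format, OF pre, unfolded fs, simplified]
  show "bounded_state cap M (snd (bind_prog f g s)) \<and>
    (fst (bind_prog f g s) \<noteq> None \<longrightarrow>
       coll_size (snd (bind_prog f g s)) \<le> c'' \<and> out_size (snd (bind_prog f g s)) \<le> x'') \<and>
    length (msgs (snd (bind_prog f g s))) \<le> length (msgs s) + (k + k') \<and>
    user_work (snd (bind_prog f g s)) \<le> user_work s + (u + u') \<and>
    server_work (snd (bind_prog f g s)) \<le> server_work s + (w + w')"
  proof (cases r)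
    case None
    with f fs show ?thesis by (simp add: bind_prog_def)
  next
    case (Some a)
    with f assms(2)[of a, unfolded bounded_prog_def, rule_format, of s'] fs
    show ?thesis by (simp add: bind_prog_def)
  qed
qed

lemma bounded_prog_ret: "bounded_prog cap M c x (ret a) c x 0 0 0"
  by (simp add: bounded_prog_def ret_def)

text \<open>Sizes are claimed only for successful runs, so \<open>c'\<close> and \<open>x'\<close>
  are arbitrary. Both branches of the overflow test can thus share a triple.\<close>

lemma bounded_prog_stop_fail: "bounded_prog cap M c x stop_fail c' x' 0 0 0"
  by (simp add: bounded_prog_def stop_fail_def)

section \<open>Peaks and local steps of the user\<close>

lemma update_peaks_simps [simp]:
  "server (update_peaks s) = server s" "inbuf (update_peaks s) = inbuf s"
  "colls (update_peaks s) = colls s" "outbuf (update_peaks s) = outbuf s"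
  "msgs (update_peaks s) = msgs s" "user_work (update_peaks s) = user_work s"
  "server_work (update_peaks s) = server_work s"
  by (simp_all add: update_peaks_def)

lemma coll_out_size_update_peaks [simp]:
  "coll_size (update_peaks s) = coll_size s" "out_size (update_peaks s) = out_size s"
  by (simp_all add: coll_size_def out_size_def)

lemma storage_size_le:
  assumes "\<And>a. length (server s a) \<le> cap a"
  shows "storage_size s \<le> total_cap cap"
  using assms[of Arr_I] assms[of Arr_T1] assms[of Arr_T2] assms[of Arr_O]
  by (simp add: storage_size_def total_cap_def)

lemma bounded_state_update_peaks:
  assumes "bounded_state cap M s"
  shows "bounded_state cap M (update_peaks s)"
proof -
  have "private_size s \<le> 4 + 4 * M"
    using assms by (auto simp: bounded_state_def private_size_def coll_size_def out_size_def)
  moreover have "storage_size s \<le> total_cap cap"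
    using assms by (auto simp: bounded_state_def intro: storage_size_le)
  \<comment> \<open>The first call keeps \<open>update_peaks\<close> folded so that the size rules
    apply; only the two peak fields need its definition.\<close>
  ultimately show ?thesis
    using assms by (simp add: bounded_state_def) (simp add: update_peaks_def)
qed

lemma bounded_prog_user_step:
  assumes "\<And>s. coll_size s \<le> c \<Longrightarrow> coll_size (snd (f s)) \<le> c'"
    and "\<And>s. out_size s \<le> x \<Longrightarrow> out_size (snd (f s)) \<le> x'"
    and "\<And>s. length (inbuf (snd (f s))) \<le> length (inbuf s)"
    and "\<And>s. server (snd (f s)) = server s"
    and "\<And>s. msgs (snd (f s)) = msgs s"
    and "\<And>s. private_peak (snd (f s)) = private_peak s"
    and "\<And>s. storage_peak (snd (f s)) = storage_peak s"
    and "\<And>s. user_work (snd (f s)) = user_work s"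
    and "\<And>s. server_work (snd (f s)) = server_work s"
    and "c' \<le> 2 * M" "x' \<le> M"
  shows "bounded_prog cap M c x (user_step u f) c' x' 0 u 0"
  unfolding bounded_prog_def
proof (intro allI impI)
  fix s :: "('a, 'b) machine"
  assume pre: "bounded_state cap M s \<and> coll_size s \<le> c \<and> out_size s \<le> x"
  obtain a s' where fs: "f s = (a, s')" by (cases "f s")
  \<comment> \<open>\<open>s''\<close> carries the charged work but still the old peaks; the
    invariant is shown for it and then transferred through \<open>update_peaks\<close>.\<close>
  define s'' where "s'' = s'\<lparr>user_work := user_work s' + u\<rparr>"
  note f = assms(1-9)[of s, unfolded fs snd_conv]
  have sz: "coll_size s'' = coll_size s'" "out_size s'' = out_size s'"
    by (simp_all add: s''_def coll_size_def out_size_def)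
  have "bounded_state cap M s''"
    using pre f assms(10,11) sz unfolding bounded_state_def by (auto simp: s''_def)
  then have "bounded_state cap M (update_peaks s'')" by (rule bounded_state_update_peaks)
  moreover have "user_step u f s = (Some a, update_peaks s'')"
    by (simp add: user_step_def fs s''_def)
  ultimately show "bounded_state cap M (snd (user_step u f s)) \<and>
    (fst (user_step u f s) \<noteq> None \<longrightarrow>
       coll_size (snd (user_step u f s)) \<le> c' \<and> out_size (snd (user_step u f s)) \<le> x') \<and>
    length (msgs (snd (user_step u f s))) \<le> length (msgs s) + 0 \<and>
    user_work (snd (user_step u f s)) \<le> user_work s + u \<and>
    server_work (snd (user_step u f s)) \<le> server_work s + 0"
    using pre f sz by (simp add: s''_def)
qed

text \<open>For steps that only charge work. The size limits of the invariant are inherited from the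
  old state, so \<open>c\<close> and \<open>x\<close> may be arbitrary here.\<close>

lemma bounded_prog_same:
  assumes "\<And>s. bounded_state cap M s \<Longrightarrow> snd (f s) = update_peaks (s\<lparr>user_work := user_work s + u\<rparr>)"
  shows "bounded_prog cap M c x f c x 0 u 0"
  unfolding bounded_prog_def
proof (intro allI impI)
  fix s :: "('a, 'b) machine"
  assume pre: "bounded_state cap M s \<and> coll_size s \<le> c \<and> out_size s \<le> x"
  have sz: "coll_size (s\<lparr>user_work := v\<rparr>) = coll_size s"
    "out_size (s\<lparr>user_work := v\<rparr>) = out_size s" for v
    by (simp_all add: coll_size_def out_size_def)
  have "bounded_state cap M (s\<lparr>user_work := user_work s + u\<rparr>)"
    using pre sz by (simp add: bounded_state_def)
  then show "bounded_state cap M (snd (f s)) \<and>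
    (fst (f s) \<noteq> None \<longrightarrow> coll_size (snd (f s)) \<le> c \<and> out_size (snd (f s)) \<le> x) \<and>
    length (msgs (snd (f s))) \<le> length (msgs s) + 0 \<and>
    user_work (snd (f s)) \<le> user_work s + u \<and>
    server_work (snd (f s)) \<le> server_work s + 0"
    using pre assms[of s] sz by (simp add: bounded_state_update_peaks)
qed

lemma bounded_prog_tick: "bounded_prog cap M c x tick c x 0 1 0"
  by (rule bounded_prog_same) (simp add: tick_def user_step_def)

lemma bounded_prog_eval_perm: "bounded_prog cap M c x (eval_perm \<rho> a) c x 0 1 0"
  by (rule bounded_prog_same) (simp add: eval_perm_def user_step_def)

lemma bounded_prog_coll_length: "bounded_prog cap M c x (coll_length i) c x 0 1 0"
  by (rule bounded_prog_same) (simp add: coll_length_def user_step_def)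

text \<open>The size bounds form a loop invariant that is linear in the position \<open>j\<close>,
  with increments \<open>dc\<close> and \<open>dx\<close>. The extra user step per iteration is the
  \<open>tick\<close> of \<open>for_each\<close>.\<close>

lemma bounded_prog_for_each:
  assumes "\<And>i j. i \<in> set is \<Longrightarrow> j < length is \<Longrightarrow>
    bounded_prog cap M (c + j * dc) (x + j * dx) (f i) (c + Suc j * dc) (x + Suc j * dx) k u w"
  shows "bounded_prog cap M c x (for_each is f) (c + length is * dc) (x + length is * dx)
    (length is * k) (length is * (u + 1)) (length is * w)"
  using assms
proof (induction "is" arbitrary: c x)
  case Nil
  then show ?case by (simp add: bounded_prog_ret)
next
  case (Cons i "is")
  have hd: "bounded_prog cap M c x (f i) (c + dc) (x + dx) k u w"
    using Cons.prems[of i 0] by simp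
  have tl: "bounded_prog cap M (c + dc) (x + dx) (for_each is f)
    (c + dc + length is * dc) (x + dx + length is * dx)
    (length is * k) (length is * (u + 1)) (length is * w)"
  proof (rule Cons.IH)
    fix i' j assume "i' \<in> set is" "j < length is"
    then show "bounded_prog cap M (c + dc + j * dc) (x + dx + j * dx) (f i')
      (c + dc + Suc j * dc) (x + dx + Suc j * dx) k u w"
      using Cons.prems[of i' "Suc j"] by (simp add: add.assoc)
  qed
  show ?case
    unfolding for_each.simps
    by (rule bounded_prog_weaken
          [OF bounded_prog_bind[OF bounded_prog_tick bounded_prog_bind[OF hd tl]]])
      (simp_all add: algebra_simps)
qed

lemma bounded_prog_for_each_const:
  assumes "\<And>i. i \<in> set is \<Longrightarrow> bounded_prog cap M c x (f i) c x k u w"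
  shows "bounded_prog cap M c x (for_each is f) c x
    (length is * k) (length is * (u + 1)) (length is * w)"
  using bounded_prog_for_each[of "is" cap M c 0 x 0 f k u w] assms by simp

lemma bounded_prog_decrypt_next:
  assumes "c \<le> 2 * M" "x \<le> M"
  shows "bounded_prog cap M c x (decrypt_next dec) c x 0 1 0"
  unfolding decrypt_next_def
  by (rule bounded_prog_user_step)
    (use assms in \<open>auto simp: coll_size_def out_size_def split: list.split\<close>)

text \<open>An inequality, because an update beyond the end of the list is void. The bound therefore
  covers any index computed from the data.\<close>

lemma sum_length_update_snoc:
  "sum_list (map length (xss[i := xss ! i @ [e]])) \<le> Suc (sum_list (map length xss))"
  by (induction xss arbitrary: i) (auto split: nat.split)

lemma sum_length_update_tl:
  "xss ! i = y # ys \<Longrightarrow> sum_list (map length (xss[i := ys])) \<le> sum_list (map length xss)"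
  by (induction xss arbitrary: i) (auto split: nat.split)

lemma sum_length_update_slot:
  "sum_list (map length (xss[i := (xss ! i)[t := e]])) = sum_list (map length xss)"
  by (induction xss arbitrary: i) (auto split: nat.split)

lemma bounded_prog_push:
  assumes "c + 1 \<le> 2 * M" "x \<le> M"
  shows "bounded_prog cap M c x (push i e) (c + 1) x 0 1 0"
  unfolding push_def
  by (rule bounded_prog_user_step)
    (use assms in \<open>auto simp: coll_size_def out_size_def
       intro: order_trans[OF sum_length_update_snoc]\<close>)

lemma bounded_prog_place:
  assumes "c \<le> 2 * M" "x \<le> M"
  shows "bounded_prog cap M c x (place t e) c x 0 1 0"
  unfolding place_def
  by (rule bounded_prog_user_step)
    (use assms in \<open>auto simp: coll_size_def out_size_def sum_length_update_slot\<close>)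

text \<open>The bound \<open>c\<close> is kept although an element leaves a collection, so the peak
  counts the collections and the output buffer both at full size.\<close>

lemma bounded_prog_encrypt_next:
  assumes "c \<le> 2 * M" "x + 1 \<le> M"
  shows "bounded_prog cap M c x (encrypt_next enc i) c (x + 1) 0 1 0"
  unfolding encrypt_next_def
  by (rule bounded_prog_user_step)
    (use assms in \<open>auto simp: coll_size_def out_size_def split: list.split
       intro: order_trans[OF sum_length_update_snoc] order_trans[OF sum_length_update_tl]\<close>)

lemma bounded_prog_new_colls:
  assumes "x \<le> M"
  shows "bounded_prog cap M c x (new_colls k) 0 x 0 k 0"
  unfolding new_colls_def
  by (rule bounded_prog_user_step)
    (use assms in \<open>auto simp: coll_size_def out_size_def sum_list_replicate\<close>)

lemma bounded_prog_new_outbuf: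
  assumes "c \<le> 2 * M"
  shows "bounded_prog cap M c x (new_outbuf k) c 0 0 k 0"
  unfolding new_outbuf_def
  by (rule bounded_prog_user_step)
    (use assms in \<open>auto simp: coll_size_def out_size_def sum_list_replicate\<close>)

lemma bounded_prog_new_slots:
  assumes "k \<le> 2 * M" "x \<le> M"
  shows "bounded_prog cap M c x (new_slots k) k x 0 k 0"
  unfolding new_slots_def
  by (rule bounded_prog_user_step)
    (use assms in \<open>auto simp: coll_size_def out_size_def\<close>)

section \<open>Operations on the server\<close>

text \<open>Operations such as \<open>getRange\<close> compute message size, costs and effect from
  the current state before they call \<open>server_op\<close>; the existential lets
  \<open>m\<close>, \<open>u\<close>, \<open>w\<close> and \<open>h\<close> depend on
  \<open>s\<close>.\<close>

lemma bounded_prog_server_op: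
  assumes "\<And>s. bounded_state cap M s \<Longrightarrow> coll_size s \<le> c \<Longrightarrow> out_size s \<le> x \<Longrightarrow>
    \<exists>m u w h. f s = server_op m u w h s \<and> bounded_state cap M (h s) \<and>
      coll_size (h s) \<le> c' \<and> out_size (h s) \<le> x' \<and> msgs (h s) = msgs s \<and>
      user_work (h s) = user_work s \<and> server_work (h s) = server_work s \<and>
      m \<le> M \<and> u + m \<le> u' \<and> w \<le> w'"
  shows "bounded_prog cap M c x f c' x' 1 u' w'"
  unfolding bounded_prog_def
proof (intro allI impI)
  fix s :: "('a, 'b) machine"
  assume pre: "bounded_state cap M s \<and> coll_size s \<le> c \<and> out_size s \<le> x"
  then obtain m u w h where h: "f s = server_op m u w h s" "bounded_state cap M (h s)"
      "coll_size (h s) \<le> c'" "out_size (h s) \<le> x'" "msgs (h s) = msgs s"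
      "user_work (h s) = user_work s" "server_work (h s) = server_work s"
      "m \<le> M" "u + m \<le> u'" "w \<le> w'"
    using assms[of s] by blast
  define s'' where "s'' = (h s)\<lparr>msgs := msgs (h s) @ [m], user_work := user_work (h s) + u + m,
        server_work := server_work (h s) + w\<rparr>"
  have sz: "coll_size s'' = coll_size (h s)" "out_size s'' = out_size (h s)"
    by (simp_all add: s''_def coll_size_def out_size_def)
  have "bounded_state cap M s''"
    using h sz unfolding bounded_state_def by (auto simp: s''_def)
  then have "bounded_state cap M (update_peaks s'')" by (rule bounded_state_update_peaks)
  moreover have "f s = (Some (), update_peaks s'')"
    by (simp add: h(1) server_op_def s''_def Let_def)
  ultimately show "bounded_state cap M (snd (f s)) \<and>
    (fst (f s) \<noteq> None \<longrightarrow> coll_size (snd (f s)) \<le> c' \<and> out_size (snd (f s)) \<le> x') \<and>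
    length (msgs (snd (f s))) \<le> length (msgs s) + 1 \<and>
    user_work (snd (f s)) \<le> user_work s + u' \<and>
    server_work (snd (f s)) \<le> server_work s + w'"
    using h sz by (simp add: s''_def)
qed

lemma bounded_prog_getRange:
  assumes "l \<le> M"
  shows "bounded_prog cap M c x (getRange A loc l) c x 1 (1 + l) l"
proof (rule bounded_prog_server_op)
  fix s :: "('a, 'b) machine"
  assume s: "bounded_state cap M s" "coll_size s \<le> c" "out_size s \<le> x"
  define xs where "xs = take l (drop loc (server s A))"
  have len: "length xs \<le> l" by (simp add: xs_def)
  have "getRange A loc l s = server_op (length xs) 1 (length xs) (\<lambda>s. s\<lparr>inbuf := xs\<rparr>) s"
    by (simp add: getRange_def xs_def Let_def)
  then show "\<exists>m u w h. getRange A loc l s = server_op m u w h s \<and> bounded_state cap M (h s) \<and>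
      coll_size (h s) \<le> c \<and> out_size (h s) \<le> x \<and> msgs (h s) = msgs s \<and>
      user_work (h s) = user_work s \<and> server_work (h s) = server_work s \<and>
      m \<le> M \<and> u + m \<le> 1 + l \<and> w \<le> l"
    \<comment> \<open>Matching the chained equation with the first conjunct fixes all four
      witnesses.\<close>
    by (intro exI conjI, assumption)
      (use s len assms in \<open>auto simp: bounded_state_def coll_size_def out_size_def\<close>)
qed

lemma length_write_range [simp]: "length (write_range loc xs A) = length A"
  by (simp add: write_range_def)

lemma length_fold_write_range [simp]:
  "length (fold (\<lambda>(loc, xs). write_range loc xs) ps A) = length A"
  by (induction ps arbitrary: A) (auto simp: case_prod_beta)

text \<open>The message size is read off the output buffer, and \<open>write_range\<close> preserves
  the length of the array, so the capacities survive for any locations.\<close>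

lemma bounded_prog_putRangeDist:
  assumes "x \<le> M"
  shows "bounded_prog cap M c x (putRangeDist A locs) c 0 1 (1 + length locs + x) x"
proof (rule bounded_prog_server_op)
  fix s :: "('a, 'b) machine"
  assume s: "bounded_state cap M s" "coll_size s \<le> c" "out_size s \<le> x"
  define A' where "A' = fold (\<lambda>(loc, xs). write_range loc xs) (zip locs (outbuf s)) (server s A)"
  have len: "length A' = length (server s A)" by (simp add: A'_def)
  have "putRangeDist A locs s = server_op (out_size s) (1 + length locs) (out_size s)
          (\<lambda>s. s\<lparr>server := (server s)(A := A'), outbuf := []\<rparr>) s"
    by (simp add: putRangeDist_def A'_def Let_def out_size_def)
  then show "\<exists>m u w h. putRangeDist A locs s = server_op m u w h s \<and> bounded_state cap M (h s) \<and>
      coll_size (h s) \<le> c \<and> out_size (h s) \<le> 0 \<and> msgs (h s) = msgs s \<and>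
      user_work (h s) = user_work s \<and> server_work (h s) = server_work s \<and>
      m \<le> M \<and> u + m \<le> 1 + length locs + x \<and> w \<le> x"
    by (intro exI conjI, assumption)
      (use s len assms in \<open>auto simp: bounded_state_def coll_size_def out_size_def\<close>)
qed

lemma bounded_prog_allocate:
  assumes "l \<le> cap A"
  shows "bounded_prog cap M c x (allocate A l) c x 1 1 l"
proof (rule bounded_prog_server_op)
  fix s :: "('a, 'b) machine"
  assume s: "bounded_state cap M s" "coll_size s \<le> c" "out_size s \<le> x"
  have "allocate A l s =
      server_op 0 1 l (\<lambda>s. s\<lparr>server := (server s)(A := replicate l undefined)\<rparr>) s"
    by (simp add: allocate_def)
  then show "\<exists>m u w h. allocate A l s = server_op m u w h s \<and> bounded_state cap M (h s) \<and>
      coll_size (h s) \<le> c \<and> out_size (h s) \<le> x \<and> msgs (h s) = msgs s \<and>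
      user_work (h s) = user_work s \<and> server_work (h s) = server_work s \<and>
      m \<le> M \<and> u + m \<le> 1 \<and> w \<le> l"
    by (intro exI conjI, assumption)
      (use s assms in \<open>auto simp: bounded_state_def coll_size_def out_size_def\<close>)
qed

lemma bounded_prog_copy_array:
  assumes "cap B \<le> cap A"
  shows "bounded_prog cap M c x (copy_array A B) c x 1 1 (cap B)"
proof (rule bounded_prog_server_op)
  fix s :: "('a, 'b) machine"
  assume s: "bounded_state cap M s" "coll_size s \<le> c" "out_size s \<le> x"
  have "length (server s B) \<le> cap B" using s by (simp add: bounded_state_def)
  then have len: "length (server s B) \<le> cap B" "length (server s B) \<le> cap A"
    using assms by simp_all
  have "copy_array A B s = server_op 0 1 (length (server s B))
      (\<lambda>s. s\<lparr>server := (server s)(A := server s B)\<rparr>) s"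
    by (simp add: copy_array_def)
  then show "\<exists>m u w h. copy_array A B s = server_op m u w h s \<and> bounded_state cap M (h s) \<and>
      coll_size (h s) \<le> c \<and> out_size (h s) \<le> x \<and> msgs (h s) = msgs s \<and>
      user_work (h s) = user_work s \<and> server_work (h s) = server_work s \<and>
      m \<le> M \<and> u + m \<le> 1 \<and> w \<le> cap B"
    by (intro exI conjI, assumption)
      (use s len in \<open>auto simp: bounded_state_def coll_size_def out_size_def\<close>)
qed

section \<open>Processing one bucket\<close>

text \<open>Each position adds at most one element and costs at most four steps: loop
  \<open>tick\<close>, decryption, evaluation of \<open>\<rho>\<close> and \<open>push\<close>. The
  summand \<open>q\<close> pays for \<open>new_colls\<close>.\<close>

lemma bounded_prog_collect:
  fixes dec :: "'ct \<Rightarrow> 'v cell"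
  assumes "l \<le> 2 * M" "x \<le> M"
  shows "bounded_prog cap M c x (collect dec q l \<rho> idx) l x 0 (q + l * 4) 0"
proof -
  have "bounded_prog cap M (0 + j * 1) (x + j * 0)
      (bind_prog (decrypt_next dec) (\<lambda>e. case e of Dummy \<Rightarrow> ret ()
         | Elem y v \<Rightarrow> bind_prog (eval_perm \<rho> y) (\<lambda>t. push (idx t) e)))
      (0 + Suc j * 1) (x + Suc j * 0) 0 3 0" if "j < l" for j
  proof (rule bounded_prog_weaken[OF bounded_prog_bind])
    show "bounded_prog cap M j x (decrypt_next dec) j x 0 1 0"
      using that assms by (intro bounded_prog_decrypt_next) auto
    fix e :: "'v cell"
    show "bounded_prog cap M j x (case e of Dummy \<Rightarrow> ret ()
         | Elem y v \<Rightarrow> bind_prog (eval_perm \<rho> y) (\<lambda>t. push (idx t) e)) (Suc j) x 0 2 0"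
    proof (cases e)
      case Dummy
      then show ?thesis
        by (auto intro: bounded_prog_weaken[OF bounded_prog_ret])
    next
      case (Elem y v)
      have "bounded_prog cap M j x (bind_prog (eval_perm \<rho> y) (\<lambda>t. push (idx t) e))
          (j + 1) x (0 + 0) (1 + 1) (0 + 0)"
        using that assms
        by (intro bounded_prog_bind[OF bounded_prog_eval_perm] bounded_prog_push) auto
      with Elem show ?thesis by (simp add: numeral_2_eq_2)
    qed
  qed auto
  then have loop: "bounded_prog cap M 0 x (for_each [0..<l] (\<lambda>_.
      bind_prog (decrypt_next dec) (\<lambda>e. case e of Dummy \<Rightarrow> ret ()
         | Elem y v \<Rightarrow> bind_prog (eval_perm \<rho> y) (\<lambda>t. push (idx t) e))))
      (0 + length [0..<l] * 1) (x + length [0..<l] * 0)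
      (length [0..<l] * 0) (length [0..<l] * (3 + 1)) (length [0..<l] * 0)"
    by (intro bounded_prog_for_each) auto
  show ?thesis
    unfolding collect_def
    by (rule bounded_prog_weaken[OF bounded_prog_bind
          [OF bounded_prog_new_colls[OF assms(2)] loop]]) auto
qed

text \<open>The truncated difference \<open>b - l\<close> is at most \<open>b\<close> for every
  \<open>l\<close>, so the growth is bounded without relating \<open>l\<close> to the
  collection.\<close>

lemma bounded_prog_pad:
  assumes "c + b \<le> 2 * M" "x \<le> M"
  shows "bounded_prog cap M c x
    (bind_prog (coll_length i) (\<lambda>l. for_each [0..<b - l] (\<lambda>_. push i Dummy)))
    (c + b) x 0 (1 + b * 2) 0"
proof -
  have "bounded_prog cap M c x (for_each [0..<b - l] (\<lambda>_. push i Dummy)) (c + b) x 0 (b * 2) 0"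
    for l
  proof -
    have "bounded_prog cap M (c + j * 1) (x + j * 0) (push i Dummy)
        (c + Suc j * 1) (x + Suc j * 0) 0 1 0" if "j < b - l" for j
      by (rule bounded_prog_weaken[OF bounded_prog_push[of "c + j" M x]])
        (use that assms in auto)
    then have "bounded_prog cap M c x (for_each [0..<b - l] (\<lambda>_. push i Dummy))
        (c + length [0..<b - l] * 1) (x + length [0..<b - l] * 0)
        (length [0..<b - l] * 0) (length [0..<b - l] * (1 + 1)) (length [0..<b - l] * 0)"
      by (intro bounded_prog_for_each) auto
    then show ?thesis by (rule bounded_prog_weaken) auto
  qed
  from bounded_prog_bind[OF bounded_prog_coll_length this] show ?thesis by simp
qed

lemma bounded_prog_encrypt_loop:
  assumes "c \<le> 2 * M" "x + l \<le> M"
  shows "bounded_prog cap M c x (for_each [0..<l] (\<lambda>_. encrypt_next enc i)) c (x + l) 0 (l * 2) 0"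
proof -
  have "bounded_prog cap M (c + j * 0) (x + j * 1) (encrypt_next enc i)
      (c + Suc j * 0) (x + Suc j * 1) 0 1 0" if "j < l" for j
    by (rule bounded_prog_weaken[OF bounded_prog_encrypt_next[of c M "x + j"]])
      (use that assms in auto)
  then have "bounded_prog cap M c x (for_each [0..<l] (\<lambda>_. encrypt_next enc i))
      (c + length [0..<l] * 0) (x + length [0..<l] * 1)
      (length [0..<l] * 0) (length [0..<l] * (1 + 1)) (length [0..<l] * 0)"
    by (intro bounded_prog_for_each) auto
  then show ?thesis by (rule bounded_prog_weaken) auto
qed

lemma Suc_mult_le: "j < q \<Longrightarrow> j * b + b \<le> q * (b::nat)"
  by (metis Suc_leI add.commute mult_Suc mult_le_mono1)

text \<open>User steps: \<open>2 * q\<close> for the overflow test,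
  \<open>2 * q + 2 * (q * b)\<close> for padding, \<open>q\<close> for the new buffer,
  \<open>q + 2 * (q * b)\<close> for encryption and \<open>1 + q + q * b\<close> for
  sending.\<close>

lemma bounded_prog_send_batches:
  assumes "c \<le> M" "x \<le> M" "q * b \<le> M" "length locs = q"
  shows "bounded_prog cap M c x (send_batches enc q T b locs) (2 * M) M
    1 (1 + 7 * q + 5 * (q * b)) (q * b)"
proof -
  have "bounded_prog cap M c x (bind_prog (coll_length i)
      (\<lambda>l. if l > b then stop_fail else ret ())) c x (0 + 0) (1 + 0) (0 + 0)" for i
    by (rule bounded_prog_bind[OF bounded_prog_coll_length])
      (auto intro: bounded_prog_stop_fail bounded_prog_ret)
  then have check: "bounded_prog cap M c x (for_each [0..<q] (\<lambda>i. bind_prog (coll_length i)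
      (\<lambda>l. if l > b then stop_fail else ret ()))) c x
      (length [0..<q] * 0) (length [0..<q] * (1 + 1)) (length [0..<q] * 0)"
    by (intro bounded_prog_for_each_const) simp
  have "bounded_prog cap M (c + j * b) (x + j * 0)
      (bind_prog (coll_length i) (\<lambda>l. for_each [0..<b - l] (\<lambda>_. push i Dummy)))
      (c + Suc j * b) (x + Suc j * 0) 0 (1 + b * 2) 0" if "j < q" for i j
    by (rule bounded_prog_weaken[OF bounded_prog_pad[of "c + j * b" b M x]])
      (use Suc_mult_le[OF that, of b] assms in auto)
  then have pad: "bounded_prog cap M c x (for_each [0..<q] (\<lambda>i.
      bind_prog (coll_length i) (\<lambda>l. for_each [0..<b - l] (\<lambda>_. push i Dummy))))
      (c + length [0..<q] * b) (x + length [0..<q] * 0)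
      (length [0..<q] * 0) (length [0..<q] * ((1 + b * 2) + 1)) (length [0..<q] * 0)"
    by (intro bounded_prog_for_each) auto
  \<comment> \<open>The bound after padding, which is the constant collection bound of the
    encryption loop, where only the output buffer grows.\<close>
  define c' where "c' = c + length [0..<q] * b"
  have c': "c' \<le> 2 * M" using assms by (simp add: c'_def)
  have "bounded_prog cap M (c' + j * 0) (0 + j * b)
      (for_each [0..<b] (\<lambda>_. encrypt_next enc i))
      (c' + Suc j * 0) (0 + Suc j * b) 0 (b * 2) 0" if "j < q" for i j
    by (rule bounded_prog_weaken[OF bounded_prog_encrypt_loop[of c' M "j * b" b]])
      (use Suc_mult_le[OF that, of b] assms c' in auto)
  then have encr: "bounded_prog cap M c' 0
      (for_each [0..<q] (\<lambda>i. for_each [0..<b] (\<lambda>_. encrypt_next enc i)))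
      (c' + length [0..<q] * 0) (0 + length [0..<q] * b)
      (length [0..<q] * 0) (length [0..<q] * (b * 2 + 1)) (length [0..<q] * 0)"
    by (intro bounded_prog_for_each) auto
  have put: "bounded_prog cap M (c' + length [0..<q] * 0) (0 + length [0..<q] * b)
      (putRangeDist T locs) (c' + length [0..<q] * 0) 0
      1 (1 + length locs + (0 + length [0..<q] * b)) (0 + length [0..<q] * b)"
    using assms by (intro bounded_prog_putRangeDist) simp
  show ?thesis
    unfolding send_batches_def
    by (rule bounded_prog_weaken[OF bounded_prog_bind[OF check bounded_prog_bind[OF pad[folded c'_def]
          bounded_prog_bind[OF bounded_prog_new_outbuf[OF c']
          bounded_prog_bind[OF encr put]]]]])
      (use assms c' in \<open>auto simp: c'_def algebra_simps\<close>)
qed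

text \<open>The common body of both distribution phases. Its size bounds before and after are the
  limits of the invariant, so it can be iterated without growth. The user's total
  \<open>2 + 5 * l + 8 * q + 5 * (q * b)\<close> explains the constant 18.\<close>

lemma bounded_prog_distribute_bucket:
  assumes "l \<le> M" "q * b \<le> M" "q \<le> M" "length locs = q"
  shows "bounded_prog cap M (2 * M) M
    (bind_prog (getRange A loc l) (\<lambda>_. bind_prog (collect dec q l \<rho> idx)
       (\<lambda>_. send_batches enc q T b locs))) (2 * M) M 2 (18 * (M + 1)) (2 * M)"
proof -
  have get: "bounded_prog cap M (2 * M) M (getRange A loc l) (2 * M) M 1 (1 + l) l"
    using assms by (intro bounded_prog_getRange)
  have col: "bounded_prog cap M (2 * M) M (collect dec q l \<rho> idx) l M 0 (q + l * 4) 0"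
    using assms by (intro bounded_prog_collect) auto
  have send: "bounded_prog cap M l M (send_batches enc q T b locs) (2 * M) M
    1 (1 + 7 * q + 5 * (q * b)) (q * b)"
    using assms by (intro bounded_prog_send_batches) auto
  show ?thesis
    by (rule bounded_prog_weaken[OF bounded_prog_bind[OF get bounded_prog_bind[OF col send]]])
      (use assms in auto)
qed

section \<open>The three phases and a single pass\<close>

lemma bounded_prog_distribution1:
  assumes "q ^ 2 \<le> M" "q * b1 \<le> M"
  shows "bounded_prog cap M (2 * M) M (distribution1 enc dec q b1 In T1 \<rho>) (2 * M) M
    (q ^ 2 * 2) (q ^ 2 * (20 * (M + 1))) (q ^ 2 * (2 * M))"
proof -
  have q: "q \<le> M" using assms(1) by (metis le_square le_trans power2_eq_square)
  have "bounded_prog cap M (2 * M) M (distribution1 enc dec q b1 In T1 \<rho>) (2 * M) M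
    (length [0..<q ^ 2] * 2) (length [0..<q ^ 2] * (18 * (M + 1) + 1)) (length [0..<q ^ 2] * (2 * M))"
    unfolding distribution1_def
    by (intro bounded_prog_for_each_const bounded_prog_distribute_bucket)
      (use assms q in auto)
  then show ?thesis by (rule bounded_prog_weaken) auto
qed

lemma bounded_prog_distribution2:
  assumes "q ^ 2 \<le> M" "q * b1 \<le> M" "q * b2 \<le> M"
  shows "bounded_prog cap M (2 * M) M (distribution2 enc dec q b1 b2 T1 T2 \<rho>) (2 * M) M
    (q ^ 2 * 2) (q ^ 2 * (20 * (M + 1))) (q ^ 2 * (2 * M))"
proof -
  have q: "q \<le> M" using assms(1) by (metis le_square le_trans power2_eq_square)
  have "bounded_prog cap M (2 * M) M (distribution2 enc dec q b1 b2 T1 T2 \<rho>) (2 * M) M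
    (length [0..<q] * (length [0..<q] * 2))
    (length [0..<q] * (length [0..<q] * (18 * (M + 1) + 1) + 1))
    (length [0..<q] * (length [0..<q] * (2 * M)))"
    unfolding distribution2_def
    by (intro bounded_prog_for_each_const bounded_prog_distribute_bucket)
      (use assms q in auto)
  \<comment> \<open>The outer loop adds \<open>q\<close> ticks, absorbed by
    \<open>q \<le> q * q\<close>; raising 18 to 20 makes room for the ticks of both loops.\<close>
  then show ?thesis
    by (rule bounded_prog_weaken)
      (auto simp: power2_eq_square algebra_simps intro: trans_le_add1[OF le_square])
qed

text \<open>\<open>new_slots\<close> replaces the collections by a table whose size
  \<open>place\<close> preserves, so nothing grows during decryption. The user's
  \<open>4 + 5 * (q * b2) + 4 * q ^ 2\<close> steps per bucket fit the constant of the distribution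
  phases.\<close>

lemma bounded_prog_clean_up:
  fixes dec :: "'ct \<Rightarrow> 'v cell"
  assumes "q ^ 2 \<le> M" "q * b2 \<le> M"
  shows "bounded_prog cap M (2 * M) M (clean_up enc dec q b2 T2 \<rho> Out) (2 * M) M
    (q ^ 2 * 2) (q ^ 2 * (20 * (M + 1))) (q ^ 2 * (2 * M))"
proof -
  let ?l = "q * b2"
  have get: "bounded_prog cap M (2 * M) M (getRange T2 (j * ?l) ?l) (2 * M) M 1 (1 + ?l) ?l" for j
    using assms by (intro bounded_prog_getRange)
  have slots: "bounded_prog cap M (2 * M) M (new_slots (q ^ 2)) (q ^ 2) M 0 (q ^ 2) 0"
    using assms by (intro bounded_prog_new_slots) auto
  have "bounded_prog cap M (q ^ 2) M
      (bind_prog (decrypt_next dec) (\<lambda>e. case e of Dummy \<Rightarrow> ret ()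
         | Elem y v \<Rightarrow> bind_prog (eval_perm \<rho> y) (\<lambda>t. place (t mod q ^ 2) e)))
      (q ^ 2) M 0 (1 + 2) 0"
  proof (rule bounded_prog_weaken[OF bounded_prog_bind])
    show "bounded_prog cap M (q ^ 2) M (decrypt_next dec) (q ^ 2) M 0 1 0"
      using assms by (intro bounded_prog_decrypt_next) auto
    fix e :: "'v cell"
    have "bounded_prog cap M (q ^ 2) M (bind_prog (eval_perm \<rho> y) (\<lambda>t. place (t mod q ^ 2) e))
        (q ^ 2) M (0 + 0) (1 + 1) (0 + 0)" for y
      using assms by (intro bounded_prog_bind[OF bounded_prog_eval_perm] bounded_prog_place) auto
    then show "bounded_prog cap M (q ^ 2) M (case e of Dummy \<Rightarrow> ret ()
         | Elem y v \<Rightarrow> bind_prog (eval_perm \<rho> y) (\<lambda>t. place (t mod q ^ 2) e)) (q ^ 2) M 0 2 0"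
      by (cases e) (auto simp: numeral_2_eq_2 intro: bounded_prog_weaken[OF bounded_prog_ret])
  qed auto
  then have loop: "bounded_prog cap M (q ^ 2) M (for_each [0..<?l] (\<lambda>_.
      bind_prog (decrypt_next dec) (\<lambda>e. case e of Dummy \<Rightarrow> ret ()
         | Elem y v \<Rightarrow> bind_prog (eval_perm \<rho> y) (\<lambda>t. place (t mod q ^ 2) e))))
      (q ^ 2) M (length [0..<?l] * 0) (length [0..<?l] * ((1 + 2) + 1)) (length [0..<?l] * 0)"
    by (intro bounded_prog_for_each_const)
  have outb: "bounded_prog cap M (q ^ 2) M (new_outbuf 1) (q ^ 2) 0 0 1 0"
    using assms by (intro bounded_prog_new_outbuf) auto
  have encr: "bounded_prog cap M (q ^ 2) 0 (for_each [0..<q ^ 2] (\<lambda>_. encrypt_next enc 0))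
      (q ^ 2) (0 + q ^ 2) 0 (q ^ 2 * 2) 0"
    using assms by (intro bounded_prog_encrypt_loop) auto
  have put: "bounded_prog cap M (q ^ 2) (0 + q ^ 2) (putRange Out (j * q ^ 2)) (q ^ 2) 0
      1 (1 + length [j * q ^ 2] + (0 + q ^ 2)) (0 + q ^ 2)" for j
    using assms unfolding putRange_def by (intro bounded_prog_putRangeDist) simp
  have "bounded_prog cap M (2 * M) M (clean_up enc dec q b2 T2 \<rho> Out) (2 * M) M
    (length [0..<q ^ 2] * 2) (length [0..<q ^ 2] * (18 * (M + 1) + 1)) (length [0..<q ^ 2] * (2 * M))"
    unfolding clean_up_def
    by (intro bounded_prog_for_each_const bounded_prog_weaken[OF bounded_prog_bind[OF get
          bounded_prog_bind[OF slots bounded_prog_bind[OF loop bounded_prog_bind[OF outb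
          bounded_prog_bind[OF encr put]]]]]])
      (use assms in \<open>auto simp: algebra_simps\<close>)
  then show ?thesis by (rule bounded_prog_weaken) auto
qed

lemma bounded_prog_optim_shuffle_pass:
  assumes "q ^ 2 \<le> M" "q * b1 \<le> M" "q * b2 \<le> M"
  shows "bounded_prog cap M (2 * M) M (optim_shuffle_pass enc dec q b1 b2 In T1 T2 \<rho> Out)
    (2 * M) M (q ^ 2 * 6) (q ^ 2 * (60 * (M + 1))) (q ^ 2 * (6 * M))"
  unfolding optim_shuffle_pass_def
  by (rule bounded_prog_weaken[OF bounded_prog_bind[OF bounded_prog_distribution1
        bounded_prog_bind[OF bounded_prog_distribution2 bounded_prog_clean_up]]])
    (use assms in \<open>auto simp: algebra_simps\<close>)

section \<open>Explicit bounds for the whole shuffle\<close>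

definition array_cap :: "nat \<Rightarrow> nat \<Rightarrow> nat \<Rightarrow> array \<Rightarrow> nat" where
  "array_cap q b1 b2 a =
     (case a of Arr_T1 \<Rightarrow> q ^ 3 * b1 | Arr_T2 \<Rightarrow> q ^ 3 * b2 | _ \<Rightarrow> q ^ 4)"

text \<open>The sum of the bucket sizes rather than their maximum: times \<open>q ^ 2\<close> it is
  exactly the joint length of \<open>Arr_I\<close>, \<open>Arr_T1\<close> and
  \<open>Arr_T2\<close>.\<close>

definition bucket_bound :: "nat \<Rightarrow> nat \<Rightarrow> nat \<Rightarrow> nat" where
  "bucket_bound q b1 b2 = q ^ 2 + q * b1 + q * b2"

lemma total_cap_array_cap: "total_cap (array_cap q b1 b2) \<le> 2 * (q ^ 2 * bucket_bound q b1 b2)"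
  by (simp add: total_cap_def array_cap_def bucket_bound_def algebra_simps
      power2_eq_square power3_eq_cube power4_eq_xxxx)

text \<open>Beyond two passes there are two allocations and one copy, hence 3 operations, and 4 user
  steps with the \<open>tick\<close> for choosing \<open>\<pi>1\<close>. Their server work is
  \<open>q ^ 2 * M\<close>, which turns 12 into 13.\<close>

lemma bounded_prog_optim_shuffle_with:
  fixes q b1 b2 :: nat
  defines "M \<equiv> bucket_bound q b1 b2"
  shows "bounded_prog (array_cap q b1 b2) M (2 * M) M (optim_shuffle_with enc dec q b1 b2 \<pi>1 \<pi>)
    (2 * M) M (3 + q ^ 2 * 12) (4 + q ^ 2 * (120 * (M + 1))) (q ^ 2 * (13 * M))"
proof -
  have M: "q ^ 2 \<le> M" "q * b1 \<le> M" "q * b2 \<le> M"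
    by (simp_all add: M_def bucket_bound_def)
  have work: "q ^ 3 * b1 + (q ^ 3 * b2 + q ^ 4) = q ^ 2 * M"
    by (simp add: M_def bucket_bound_def algebra_simps power2_eq_square power3_eq_cube
        power4_eq_xxxx)
  let ?cap = "array_cap q b1 b2"
  have a1: "bounded_prog ?cap M (2 * M) M (allocate Arr_T1 (q ^ 3 * b1)) (2 * M) M
      1 1 (q ^ 3 * b1)"
    and a2: "bounded_prog ?cap M (2 * M) M (allocate Arr_T2 (q ^ 3 * b2)) (2 * M) M
      1 1 (q ^ 3 * b2)"
    by (intro bounded_prog_allocate; simp add: array_cap_def)+
  have cp: "bounded_prog ?cap M (2 * M) M (copy_array Arr_I Arr_O) (2 * M) M
      1 1 (q ^ 4)"
    using bounded_prog_copy_array[of ?cap Arr_O Arr_I] by (simp add: array_cap_def)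
  note pass = bounded_prog_optim_shuffle_pass[OF M]
  show ?thesis
    unfolding optim_shuffle_with_def
    by (rule bounded_prog_weaken[OF bounded_prog_bind[OF a1 bounded_prog_bind[OF a2
          bounded_prog_bind[OF bounded_prog_tick bounded_prog_bind[OF pass
          bounded_prog_bind[OF cp pass]]]]]])
      (use work in \<open>auto simp: algebra_simps\<close>)
qed

lemma bounded_state_init_machine:
  assumes "length xs = q ^ 4" "length out = q ^ 4"
  shows "bounded_state (array_cap q b1 b2) M (init_machine enc xs out)"
  unfolding init_machine_def
  by (rule bounded_state_update_peaks)
    (use assms in \<open>auto simp: bounded_state_def coll_size_def out_size_def array_cap_def
       split: array.split\<close>)

lemma optim_shuffle_with_bounds:
  fixes q b1 b2 :: nat
  defines "M \<equiv> bucket_bound q b1 b2"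
  assumes len: "length xs = q ^ 4" "length out = q ^ 4"
    and s: "s = snd (optim_shuffle_with enc dec q b1 b2 \<pi>1 \<pi> (init_machine enc xs out))"
  shows "length (msgs s) \<le> 3 + q ^ 2 * 12" "\<forall>m \<in> set (msgs s). m \<le> M"
    and "private_peak s \<le> 4 + 4 * M" "storage_peak s \<le> 2 * (q ^ 2 * M)"
    and "user_work s \<le> 4 + q ^ 2 * (120 * (M + 1))" "server_work s \<le> q ^ 2 * (13 * M)"
proof -
  let ?s0 = "init_machine enc xs out"
  have s0: "bounded_state (array_cap q b1 b2) M ?s0"
    using len by (rule bounded_state_init_machine)
  moreover have "coll_size ?s0 \<le> 2 * M" "out_size ?s0 \<le> M"
    using s0 by (simp_all add: bounded_state_def)
  moreover have "msgs ?s0 = []" "user_work ?s0 = 0" "server_work ?s0 = 0"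
    by (simp_all add: init_machine_def)
  ultimately have "bounded_state (array_cap q b1 b2) M s \<and> length (msgs s) \<le> 3 + q ^ 2 * 12 \<and>
      user_work s \<le> 4 + q ^ 2 * (120 * (M + 1)) \<and> server_work s \<le> q ^ 2 * (13 * M)"
    using bounded_prog_optim_shuffle_with[of q b1 b2 enc dec \<pi>1 \<pi>,
        folded M_def, unfolded bounded_prog_def, rule_format, of ?s0]
    by (simp add: s)
  then show "length (msgs s) \<le> 3 + q ^ 2 * 12" "\<forall>m \<in> set (msgs s). m \<le> M"
    and "private_peak s \<le> 4 + 4 * M" "storage_peak s \<le> 2 * (q ^ 2 * M)"
    and "user_work s \<le> 4 + q ^ 2 * (120 * (M + 1))" "server_work s \<le> q ^ 2 * (13 * M)"
    using total_cap_array_cap[of q b1 b2] by (auto simp: bounded_state_def M_def)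
qed

section \<open>Asymptotics in \<open>n\<close>\<close>

text \<open>Rounding up adds at most 1, hence at most \<open>q\<close> when \<open>q\<close> is
  positive, so a batch has at most \<open>(p + 1) * q\<close> elements. The constant is
  \<open>1 + (p1 + 1) + (p2 + 1)\<close>.\<close>

lemma bucket_bound_batch_size_le:
  assumes "p1 \<ge> 0" "p2 \<ge> 0"
  shows "real (bucket_bound q (batch_size p1 q) (batch_size p2 q)) \<le> (3 + p1 + p2) * real (q ^ 2)"
proof -
  have batch: "real q * real (batch_size p q) \<le> (p + 1) * real (q ^ 2)" if "p \<ge> 0" for p
  proof (cases "q = 0")
    case False
    have "real (batch_size p q) \<le> p * real q + 1"
      using that by (simp add: batch_size_def)
    also have "\<dots> \<le> (p + 1) * real q"
      using False by (simp add: algebra_simps)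
    finally have "real q * real (batch_size p q) \<le> real q * ((p + 1) * real q)"
      by (intro mult_left_mono) auto
    then show ?thesis by (simp add: power2_eq_square algebra_simps)
  qed simp
  show ?thesis
    using batch[OF assms(1)] batch[OF assms(2)] by (simp add: bucket_bound_def algebra_simps)
qed

lemma affine_sqrt_bigo: "(\<lambda>n. a + b * sqrt (real n)) \<in> O(\<lambda>n. sqrt (real n))"
proof (rule bigoI)
  show "\<forall>\<^sub>F n in sequentially. norm (a + b * sqrt (real n)) \<le> (\<bar>a\<bar> + \<bar>b\<bar>) * norm (sqrt (real n))"
    using eventually_ge_at_top[of 1]
  proof eventually_elim
    case (elim n)
    then have "1 \<le> sqrt (real n)" by simp
    then have "\<bar>a\<bar> \<le> \<bar>a\<bar> * sqrt (real n)" by (simp add: mult_le_cancel_left1)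
    moreover have "norm (a + b * sqrt (real n)) \<le> \<bar>a\<bar> + \<bar>b\<bar> * sqrt (real n)"
      by (metis abs_mult abs_of_nonneg abs_triangle_ineq of_nat_0_le_iff real_norm_def real_sqrt_ge_0_iff)
    ultimately show ?case by (simp add: algebra_simps)
  qed
qed

lemma affine_bigo: "(\<lambda>n. a + b * real n) \<in> O(\<lambda>n. real n)"
proof (rule bigoI)
  show "\<forall>\<^sub>F n in sequentially. norm (a + b * real n) \<le> (\<bar>a\<bar> + \<bar>b\<bar>) * norm (real n)"
    using eventually_ge_at_top[of 1]
  proof eventually_elim
    case (elim n)
    then have "\<bar>a\<bar> \<le> \<bar>a\<bar> * real n" by (simp add: mult_le_cancel_left1)
    moreover have "norm (a + b * real n) \<le> \<bar>a\<bar> + \<bar>b\<bar> * real n"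
      by (metis abs_mult abs_of_nat abs_triangle_ineq real_norm_def)
    ultimately show ?case by (simp add: algebra_simps)
  qed
qed

theorem theorem5p1:
  fixes p1 p2 :: real
  assumes "p1 > 1" and "p2 > 1" and "p1 \<le> p2"
  shows "\<exists>ops msg mem store uwork swork :: nat \<Rightarrow> real.
    ops \<in> O(\<lambda>n. sqrt (real n)) \<and> msg \<in> O(\<lambda>n. sqrt (real n)) \<and> mem \<in> O(\<lambda>n. sqrt (real n)) \<and>
    store \<in> O(\<lambda>n. real n) \<and> uwork \<in> O(\<lambda>n. real n) \<and> swork \<in> O(\<lambda>n. real n) \<and>
    (\<forall>n q :: nat.
     \<forall>(enc :: nat \<Rightarrow> 'v cell \<Rightarrow> 'ct) (dec :: 'ct \<Rightarrow> 'v cell).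
     \<forall>(xs :: (nat \<times> 'v) list) (\<pi> :: nat \<Rightarrow> nat) (out :: 'ct list).
       n = q ^ 4 \<and> encryption_scheme enc dec \<and> input_array n xs \<and> \<pi> permutes {1..n} \<and>
       length out = n \<longrightarrow>
       (\<forall>(result, s) \<in> set_pmf (optim_shuffle p1 p2 q enc dec xs \<pi> out).
          real (length (msgs s)) \<le> ops n \<and>
          (\<forall>m \<in> set (msgs s). real m \<le> msg n) \<and>
          real (private_peak s) \<le> mem n \<and>
          real (storage_peak s) \<le> store n \<and>
          real (user_work s) \<le> uwork n \<and>
          real (server_work s) \<le> swork n))"
proof -
  define K where "K = 3 + p1 + p2"
  \<comment> \<open>The explicit bounds after substituting \<open>q ^ 2 = sqrt n\<close> and
    \<open>M \<le> K * q ^ 2\<close>. The summands \<open>0\<close> give all six functions the shape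
    of the affine lemmas.\<close>
  define ops msg mem store uwork swork :: "nat \<Rightarrow> real"
    where "ops = (\<lambda>n. 3 + 12 * sqrt (real n))"
      and "msg = (\<lambda>n. 0 + K * sqrt (real n))"
      and "mem = (\<lambda>n. 4 + (4 * K) * sqrt (real n))"
      and "store = (\<lambda>n. 0 + (2 * K) * real n)"
      and "uwork = (\<lambda>n. 4 + (120 * (K + 1)) * real n)"
      and "swork = (\<lambda>n. 0 + (13 * K) * real n)"
  note bound_defs = ops_def msg_def mem_def store_def uwork_def swork_def
  have bounds: "real (length (msgs s)) \<le> ops n \<and> (\<forall>m \<in> set (msgs s). real m \<le> msg n) \<and>
      real (private_peak s) \<le> mem n \<and> real (storage_peak s) \<le> store n \<and>
      real (user_work s) \<le> uwork n \<and> real (server_work s) \<le> swork n"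
    if n: "n = q ^ 4" and inp: "input_array n xs" and out: "length out = n"
      and s: "(result, s) \<in> set_pmf (optim_shuffle p1 p2 q enc dec xs \<pi> out)"
    for n q :: nat and enc :: "nat \<Rightarrow> 'v cell \<Rightarrow> 'ct" and dec xs \<pi> out result s
  proof -
    define M where "M = bucket_bound q (batch_size p1 q) (batch_size p2 q)"
    \<comment> \<open>Each point of the support is a deterministic run for some
      \<open>\<pi>1\<close>, so the bounds hold for every outcome and not merely in
      expectation.\<close>
    obtain \<pi>1 where s: "s = snd (optim_shuffle_with enc dec q (batch_size p1 q) (batch_size p2 q)
        \<pi>1 \<pi> (init_machine enc xs out))"
      using s by (auto simp: optim_shuffle_def) (metis snd_conv)
    have len: "length xs = q ^ 4" "length out = q ^ 4"
      using n inp out by (auto simp: input_array_def)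
    note bounds = optim_shuffle_with_bounds[OF len s, folded M_def]
    have sqrt_n: "sqrt (real n) = real (q ^ 2)"
      by (rule real_sqrt_unique) (simp_all add: n flip: power_mult)
    have real_n: "real n = real (q ^ 2) * real (q ^ 2)"
      by (simp add: n flip: power_add)
    have M: "real M \<le> K * real (q ^ 2)"
      using assms bucket_bound_batch_size_le[of p1 p2 q] by (simp add: M_def K_def)
    have qM: "real (q ^ 2) * real M \<le> K * real n"
      using mult_left_mono[OF M, of "real (q ^ 2)"] by (simp add: real_n algebra_simps)
    \<comment> \<open>Absorbs the summand 1 of \<open>M + 1\<close> in the user's work.\<close>
    have q_n: "real (q ^ 2) \<le> real n"
      unfolding n of_nat_le_iff by (cases "q = 0") (auto intro: power_increasing)
    have "real (length (msgs s)) \<le> ops n"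
      using of_nat_mono[OF bounds(1), where 'a = real] by (simp add: bound_defs sqrt_n)
    moreover have "\<forall>m \<in> set (msgs s). real m \<le> msg n"
      using bounds(2) M by (force simp: bound_defs sqrt_n)
    moreover have "real (private_peak s) \<le> mem n"
      using of_nat_mono[OF bounds(3), where 'a = real] M by (simp add: bound_defs sqrt_n)
    moreover have "real (storage_peak s) \<le> store n"
      using of_nat_mono[OF bounds(4), where 'a = real] qM by (simp add: bound_defs)
    moreover have "real (user_work s) \<le> uwork n"
    proof -
      have "real (user_work s) \<le> 4 + 120 * (real (q ^ 2) * real M) + 120 * real (q ^ 2)"
        using of_nat_mono[OF bounds(5), where 'a = real] by (simp add: algebra_simps)
      also have "\<dots> \<le> 4 + 120 * (K * real n) + 120 * real n"
        using qM q_n by linarith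
      also have "\<dots> = uwork n" by (simp add: bound_defs algebra_simps)
      finally show ?thesis .
    qed
    moreover have "real (server_work s) \<le> swork n"
      using of_nat_mono[OF bounds(6), where 'a = real] qM by (simp add: bound_defs)
    ultimately show ?thesis by blast
  qed
  show ?thesis
  proof (intro exI conjI)
    show "ops \<in> O(\<lambda>n. sqrt (real n))" "msg \<in> O(\<lambda>n. sqrt (real n))"
      "mem \<in> O(\<lambda>n. sqrt (real n))"
      unfolding bound_defs by (rule affine_sqrt_bigo)+
    show "store \<in> O(\<lambda>n. real n)" "uwork \<in> O(\<lambda>n. real n)" "swork \<in> O(\<lambda>n. real n)"
      unfolding bound_defs by (rule affine_bigo)+
  qed (intro allI impI, clarify, rule bounds, auto)
qed

end
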